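(* Let $\mathcal{F}$ be any transitive frame and $n\ge 0$. 1. $\mathcal{F}\models\mathbb{C}_n$ iff $\mathcal{F}$ has circumference at most $n$ and has no strictly ascending chains. 2. If $\mathcal{F}$ is finite, then $\mathcal{F}\models\mathbb{C}_n$ iff $\mathcal{F}$ has circumference at most $n$.
   Context: Modal formulas are built from propositional variables by $\top,\neg,\wedge,\Box$, with $\Diamond=\neg\Box\neg$, $\Box^*\varphi=\varphi\wedge\Box\varphi$. A frame $(W,R)$ is a set with a binary relation; a model on it adds a valuation of variables, with standard Kripke truth ($\Box\varphi$ true at $x$ iff $\varphi$ true at all $R$-successors of $x$). A formula is valid in a frame if true at every point of every model on it; a scheme is valid if all its instances are. An $n$-cycle ($n\ge1$) is a sequence of $n$ distinct points $x_0,\dots,x_{n-1}$ with $x_0Rx_1R\cdots Rx_{n-1}Rx_0$. The circumference of a frame is the supremum of lengths of its cycles (0 if there are none). An ascending chain is a sequence $(x_m)_{m<\omega}$ with $x_mRx_{m+1}$ for all $m$; it is strictly ascending if never $x_{m+1}Rx_m$. Define $\mathbb{P}_0(\varphi_0)=\Diamond\varphi_0$ and for $n>0$, $\mathbb{P}_n(\varphi_0,\dots,\varphi_n)=\Diamond(\varphi_1\wedge\mathbb{P}_{n-1}(\varphi_0,\varphi_2,\dots,\varphi_n))$. Let $\mathbb{D}_n(\varphi_0,\dots,\varphi_n)=\bigwedge_{i<j\le n}\neg(\varphi_i\wedge\varphi_j)$ (which is $\top$ when $n=0$). $\mathbb{C}_n$ is the scheme $\Box^*\mathbb{D}_n(\varphi_0,\dots,\varphi_n)\to(\Diamond\varphi_0\to\Diamond(\varphi_0\wedge\neg\mathbb{P}_n(\varphi_0,\dots,\varphi_n)))$,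 i.e. all uniform substitution instances of this formula with distinct variables $p_0,\dots,p_n$ in place of the $\varphi_i$. *)

theory Defs
  imports Main "HOL-Library.Extended_Nat"
begin

datatype fm = Var nat | Top | Neg fm | And fm fm | Box fm

definition Imp :: "fm \<Rightarrow> fm \<Rightarrow> fm" where
  "Imp \<phi> \<psi> = Neg (And \<phi> (Neg \<psi>))"

definition Dia :: "fm \<Rightarrow> fm" where
  "Dia \<phi> = Neg (Box (Neg \<phi>))"

definition BoxStar :: "fm \<Rightarrow> fm" where
  "BoxStar \<phi> = And \<phi> (Box \<phi>)"

primrec Conj :: "fm list \<Rightarrow> fm" where
  "Conj [] = Top"
| "Conj (\<phi> # \<phi>s) = And \<phi> (Conj \<phi>s)"

primrec subst :: "(nat \<Rightarrow> fm) \<Rightarrow> fm \<Rightarrow> fm" where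
  "subst \<sigma> (Var p) = \<sigma> p"
| "subst \<sigma> Top = Top"
| "subst \<sigma> (Neg \<phi>) = Neg (subst \<sigma> \<phi>)"
| "subst \<sigma> (And \<phi> \<psi>) = And (subst \<sigma> \<phi>) (subst \<sigma> \<psi>)"
| "subst \<sigma> (Box \<phi>) = Box (subst \<sigma> \<phi>)"

definition frame :: "'w set \<Rightarrow> ('w \<times> 'w) set \<Rightarrow> bool" where
  "frame W R \<longleftrightarrow> R \<subseteq> W \<times> W"

primrec truth :: "('w \<times> 'w) set \<Rightarrow> (nat \<Rightarrow> 'w set) \<Rightarrow> 'w \<Rightarrow> fm \<Rightarrow> bool" where
  "truth R V x (Var p) \<longleftrightarrow> x \<in> V p"
| "truth R V x Top \<longleftrightarrow> True"
| "truth R V x (Neg \<phi>) \<longleftrightarrow> \<not> truth R V x \<phi>"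
| "truth R V x (And \<phi> \<psi>) \<longleftrightarrow> truth R V x \<phi> \<and> truth R V x \<psi>"
| "truth R V x (Box \<phi>) \<longleftrightarrow> (\<forall>y. (x, y) \<in> R \<longrightarrow> truth R V y \<phi>)"

definition valid :: "'w set \<Rightarrow> ('w \<times> 'w) set \<Rightarrow> fm \<Rightarrow> bool" where
  "valid W R \<phi> \<longleftrightarrow> (\<forall>V. (\<forall>p. V p \<subseteq> W) \<longrightarrow> (\<forall>x\<in>W. truth R V x \<phi>))"

definition valid_scheme :: "'w set \<Rightarrow> ('w \<times> 'w) set \<Rightarrow> fm set \<Rightarrow> bool" where
  "valid_scheme W R \<Phi> \<longleftrightarrow> (\<forall>\<phi>\<in>\<Phi>. valid W R \<phi>)"

text \<open>A tuple of formulas \<open>\<phi>\<^sub>0, \<dots>, \<phi>\<^sub>n\<close> is given by a sequence \<open>\<phi> :: nat \<Rightarrow> fm\<close>, of which only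
  the entries with index at most \<open>n\<close> are used. The sequence in the recursive call below is
  \<open>\<phi>\<^sub>0, \<phi>\<^sub>2, \<phi>\<^sub>3, \<dots>\<close>\<close>

fun PP :: "nat \<Rightarrow> (nat \<Rightarrow> fm) \<Rightarrow> fm" where
  "PP 0 \<phi> = Dia (\<phi> 0)"
| "PP (Suc n) \<phi> = Dia (And (\<phi> 1) (PP n (\<lambda>i. if i = 0 then \<phi> 0 else \<phi> (Suc i))))"

definition DD :: "nat \<Rightarrow> (nat \<Rightarrow> fm) \<Rightarrow> fm" where
  "DD n \<phi> = Conj [Neg (And (\<phi> i) (\<phi> j)). j \<leftarrow> [0..<Suc n], i \<leftarrow> [0..<j]]"

definition CC :: "nat \<Rightarrow> (nat \<Rightarrow> fm) \<Rightarrow> fm" where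
  "CC n \<phi> = Imp (BoxStar (DD n \<phi>))
     (Imp (Dia (\<phi> 0)) (Dia (And (\<phi> 0) (Neg (PP n \<phi>)))))"

definition C_scheme :: "nat \<Rightarrow> fm set" where
  "C_scheme n = {subst \<sigma> (CC n Var) | \<sigma>. True}"

definition cycle :: "'w set \<Rightarrow> ('w \<times> 'w) set \<Rightarrow> 'w list \<Rightarrow> bool" where
  "cycle W R xs \<longleftrightarrow> xs \<noteq> [] \<and> distinct xs \<and> set xs \<subseteq> W \<and>
     (\<forall>i<length xs. (xs ! i, xs ! (Suc i mod length xs)) \<in> R)"

text \<open>In \<^typ>\<open>enat\<close> the supremum of the empty set is \<open>0\<close>, and that of an unbounded set is \<open>\<infinity>\<close>.\<close>

definition circumference :: "'w set \<Rightarrow> ('w \<times> 'w) set \<Rightarrow> enat" where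
  "circumference W R = Sup {enat (length xs) | xs. cycle W R xs}"

definition ascending_chain :: "'w set \<Rightarrow> ('w \<times> 'w) set \<Rightarrow> (nat \<Rightarrow> 'w) \<Rightarrow> bool" where
  "ascending_chain W R x \<longleftrightarrow> (\<forall>m. x m \<in> W) \<and> (\<forall>m. (x m, x (Suc m)) \<in> R)"

definition strictly_ascending_chain :: "'w set \<Rightarrow> ('w \<times> 'w) set \<Rightarrow> (nat \<Rightarrow> 'w) \<Rightarrow> bool" where
  "strictly_ascending_chain W R x \<longleftrightarrow>
     ascending_chain W R x \<and> (\<forall>m. (x (Suc m), x m) \<notin> R)"

end

theory Submission
  imports Defs
begin

text \<open>An instance of \<open>\<C>\<^sub>n\<close> can be refuted in a transitive frame exactly when there is an ascending
  chain in which points with incongruent indices modulo \<open>n + 1\<close> differ: the formula \<open>\<P>\<^sub>n\<close> lets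
  one run from a \<open>\<phi>\<^sub>0\<close>-point through \<open>\<phi>\<^sub>1, \<dots>, \<phi>\<^sub>n\<close> back to \<open>\<phi>\<^sub>0\<close> forever, and conversely the
  residue classes of such a chain serve as values of the variables. Such a chain either has
  a strictly ascending subsequence or eventually stays in one cluster, where \<open>n + 1\<close> consecutive
  points form a cycle of length \<open>n + 1\<close>.\<close>

definition residue_separated :: "nat \<Rightarrow> (nat \<Rightarrow> 'w) \<Rightarrow> bool" where
  "residue_separated n y \<longleftrightarrow> (\<forall>i j. y i = y j \<longrightarrow> i mod Suc n = j mod Suc n)"

section \<open>Substitution and truth conditions\<close>

lemma truth_subst:
  assumes "frame W R" and "x \<in> W"
  shows "truth R V x (subst \<sigma> \<phi>) \<longleftrightarrow> truth R (\<lambda>p. {y\<in>W. truth R V y (\<sigma> p)}) x \<phi>"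
  using assms(2)
proof (induction \<phi> arbitrary: x)
  case (Box \<phi>)
  then show ?case
    using assms(1) unfolding frame_def by auto
qed auto

lemma subst_Var: "subst Var \<phi> = \<phi>"
  by (induction \<phi>) auto

text \<open>An instance under a valuation behaves like the formula in the variables under the
  valuation by the truth sets of the substituted formulas; conversely, that formula is the instance
  under \<open>Var\<close>. This reduces the scheme to a single formula.\<close>

lemma valid_scheme_C_scheme:
  assumes "frame W R"
  shows "valid_scheme W R (C_scheme n) \<longleftrightarrow> valid W R (CC n Var)"
proof
  assume "valid_scheme W R (C_scheme n)"
  then have "valid W R (subst Var (CC n Var))"
    unfolding valid_scheme_def C_scheme_def by blast
  then show "valid W R (CC n Var)"
    by (simp add: subst_Var)
next
  assume v: "valid W R (CC n Var)"
  have "valid W R (subst \<sigma> (CC n Var))" for \<sigma>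
    unfolding valid_def
  proof (intro allI impI ballI)
    fix V :: "nat \<Rightarrow> 'a set" and x assume "x \<in> W"
    then show "truth R V x (subst \<sigma> (CC n Var))"
      using v unfolding truth_subst[OF assms \<open>x \<in> W\<close>] valid_def by auto
  qed
  then show "valid_scheme W R (C_scheme n)"
    unfolding valid_scheme_def C_scheme_def by blast
qed

lemma truth_Imp [simp]: "truth R V x (Imp \<phi> \<psi>) \<longleftrightarrow> (truth R V x \<phi> \<longrightarrow> truth R V x \<psi>)"
  by (simp add: Imp_def)

lemma truth_Dia [simp]: "truth R V x (Dia \<phi>) \<longleftrightarrow> (\<exists>y. (x, y) \<in> R \<and> truth R V y \<phi>)"
  by (simp add: Dia_def)

lemma truth_BoxStar [simp]:
  "truth R V x (BoxStar \<phi>) \<longleftrightarrow> truth R V x \<phi> \<and> (\<forall>y. (x, y) \<in> R \<longrightarrow> truth R V y \<phi>)"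
  by (simp add: BoxStar_def)

lemma truth_Conj: "truth R V x (Conj \<phi>s) \<longleftrightarrow> (\<forall>\<phi>\<in>set \<phi>s. truth R V x \<phi>)"
  by (induction \<phi>s) auto

lemma truth_DD:
  "truth R V x (DD n \<phi>) \<longleftrightarrow>
     (\<forall>j\<le>n. \<forall>i<j. \<not> (truth R V x (\<phi> i) \<and> truth R V x (\<phi> j)))"
  by (simp add: DD_def truth_Conj atLeast0LessThan lessThan_Suc_atMost del: upt_Suc) blast

text \<open>Unfolding the nested diamonds yields a path. The recursive call drops
  \<open>\<phi> 1\<close> but keeps the target \<open>\<phi> 0\<close>, so the induction step
  prepends \<open>x\<close> to a path, or removes its first point.\<close>

lemma truth_PP:
  "truth R V x (PP n \<phi>) \<longleftrightarrow>
     (\<exists>f. f 0 = x \<and> (\<forall>i\<le>n. (f i, f (Suc i)) \<in> R) \<and>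
          (\<forall>i\<in>{1..n}. truth R V (f i) (\<phi> i)) \<and> truth R V (f (Suc n)) (\<phi> 0))"
proof (induction n arbitrary: x \<phi>)
  case 0
  show ?case (is "?L \<longleftrightarrow> ?R")
  proof
    assume ?L
    then obtain y where "(x, y) \<in> R" "truth R V y (\<phi> 0)" by auto
    then show ?R by (intro exI[of _ "case_nat x (\<lambda>_. y)"]) auto
  qed auto
next
  case (Suc n)
  let ?\<psi> = "\<lambda>i. if i = 0 then \<phi> 0 else \<phi> (Suc i)"
  show ?case (is "?L \<longleftrightarrow> ?R")
  proof
    assume ?L
    then obtain y where y: "(x, y) \<in> R" "truth R V y (\<phi> 1)" "truth R V y (PP n ?\<psi>)"
      by auto
    then obtain f where f: "f 0 = y" "\<forall>i\<le>n. (f i, f (Suc i)) \<in> R"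
        "\<forall>i\<in>{1..n}. truth R V (f i) (?\<psi> i)" "truth R V (f (Suc n)) (\<phi> 0)"
      unfolding Suc.IH by auto
    \<comment> \<open>At \<open>i = 0\<close> this is the conjunct \<open>\<phi> 1\<close> true at
      \<open>y\<close>; for positive \<open>i\<close> it comes from the shifted sequence
      \<open>?\<psi>\<close>.\<close>
    have "truth R V (f i) (\<phi> (Suc i))" if "i \<le> n" for i
      using that f(1,3) y(2) by (cases "i = 0") auto
    then show ?R
      using f y by (intro exI[of _ "case_nat x f"]) (auto split: nat.split)
  next
    assume ?R
    then obtain f where f: "f 0 = x" "\<forall>i\<le>Suc n. (f i, f (Suc i)) \<in> R"
        "\<forall>i\<in>{1..Suc n}. truth R V (f i) (\<phi> i)" "truth R V (f (Suc (Suc n))) (\<phi> 0)"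
      by blast
    then have "truth R V (f 1) (PP n ?\<psi>)"
      unfolding Suc.IH by (intro exI[of _ "\<lambda>i. f (Suc i)"]) auto
    moreover have "(x, f 1) \<in> R" "truth R V (f 1) (\<phi> 1)"
      using f(2)[rule_format, of 0] f(1,3) by auto
    ultimately show ?L by auto
  qed
qed

section \<open>Ascending chains in transitive frames\<close>

lemma ascending_chain_less:
  assumes "ascending_chain W R y" and "trans R" and "i < j"
  shows "(y i, y j) \<in> R"
  using assms(3)
proof (induction rule: strict_inc_induct)
  case (base i)
  then show ?case using assms(1) by (auto simp: ascending_chain_def)
next
  case (step i)
  then show ?case using assms(1,2) unfolding ascending_chain_def by (meson transD)
qed

text \<open>If the chain returned to \<open>y i\<close>, transitivity would lead from
  \<open>y (Suc i)\<close> back to \<open>y i\<close>, against strictness. An immediate return is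
  treated separately: there the edge between the two equal points is a loop.\<close>

lemma strictly_ascending_chain_inj:
  assumes "strictly_ascending_chain W R y" and "trans R"
  shows "inj y"
proof (rule linorder_injI)
  fix i j :: nat assume "i < j"
  show "y i \<noteq> y j"
  proof
    assume eq: "y i = y j"
    have "(y (Suc i), y i) \<in> R"
    proof (cases "j = Suc i")
      case True
      then show ?thesis
        using assms(1) eq unfolding strictly_ascending_chain_def ascending_chain_def by metis
    next
      case False
      then show ?thesis
        using ascending_chain_less[of W R y "Suc i" j] assms \<open>i < j\<close> eq
        by (simp add: strictly_ascending_chain_def)
    qed
    then show False
      using assms(1) by (simp add: strictly_ascending_chain_def)
  qed
qed

section \<open>Countermodels and residue-separated chains\<close>

lemma not_valid_CC_if_residue_separated:
  assumes "trans R" and "ascending_chain W R y" and "residue_separated n y"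
  shows "\<not> valid W R (CC n Var)"
proof
  assume v: "valid W R (CC n Var)"
  define V where "V p = y ` {m. m mod Suc n = p}" for p
  have y: "y m \<in> W" "(y m, y (Suc m)) \<in> R" for m
    using assms(2) by (auto simp: ascending_chain_def)
  have yV: "y m \<in> V (m mod Suc n)" for m
    unfolding V_def by blast
  have "V p \<subseteq> W" for p
    using y(1) by (auto simp: V_def)
  then have "truth R V (y 0) (CC n Var)"
    using v y(1) by (simp add: valid_def)
  moreover have "i = j" if "x \<in> V i" "x \<in> V j" for x i j
  proof -
    obtain k l where "x = y k" "k mod Suc n = i" "x = y l" "l mod Suc n = j"
      using \<open>x \<in> V i\<close> \<open>x \<in> V j\<close> unfolding V_def by blast
    then show ?thesis
      using assms(3) unfolding residue_separated_def by metis
  qed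
  then have "truth R V x (DD n Var)" for x
    unfolding truth_DD by (metis less_irrefl truth.simps(1))
  \<comment> \<open>A point of \<open>V 0\<close> occurs in \<open>y\<close> at a multiple of
    \<open>Suc n\<close>; the next \<open>Suc n\<close> steps of \<open>y\<close> visit
    \<open>V 1\<close>, ..., \<open>V n\<close> and end in \<open>V 0\<close>.\<close>
  moreover have "truth R V z (PP n Var)" if "z \<in> V 0" for z
  proof -
    obtain m where m: "m mod Suc n = 0" "z = y m"
      using \<open>z \<in> V 0\<close> unfolding V_def by (metis (mono_tags, lifting) imageE mem_Collect_eq)
    have "(m + i) mod Suc n = i" if "i \<le> n" for i
      using that m(1) by (metis add_0 le_imp_less_Suc mod_add_left_eq mod_less)
    then have "y (m + i) \<in> V i" if "i \<le> n" for i
      using that yV[of "m + i"] by metis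
    moreover have "y (m + Suc n) \<in> V 0"
      using yV[of "m + Suc n"] m(1) by (metis mod_add_self2)
    ultimately show ?thesis
      unfolding truth_PP using y(2) m(2)
      by (intro exI[of _ "\<lambda>i. y (m + i)"]) auto
  qed
  \<comment> \<open>The diamond at \<open>y 0\<close> is witnessed one period later, since
    \<open>y 0\<close> need not be related to itself.\<close>
  moreover have "(y 0, y (Suc n)) \<in> R" "y (Suc n) \<in> V 0"
    using ascending_chain_less[OF assms(2,1), of 0 "Suc n"] yV[of "Suc n"] by simp_all
  ultimately show False
    by (auto simp: CC_def)
qed

text \<open>Choose for each \<open>\<phi>\<close>-0 successor of the refuting point a path
  witnessing \<open>PP\<close>; its end is again such a successor, so the chosen paths can be
  concatenated forever.\<close>

lemma residue_separated_chain_if_not_valid_CC: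
  assumes "frame W R" and "trans R" and "\<not> valid W R (CC n Var)"
  obtains y where "ascending_chain W R y" and "residue_separated n y"
proof -
  obtain V x where "\<not> truth R V x (CC n Var)"
    using assms(3) unfolding valid_def by blast
  then obtain z0 where dd: "\<And>u. (x, u) \<in> R \<Longrightarrow> truth R V u (DD n Var)"
      and z0: "(x, z0) \<in> R" "z0 \<in> V 0"
      and pp: "\<And>z. (x, z) \<in> R \<Longrightarrow> z \<in> V 0 \<Longrightarrow> truth R V z (PP n Var)"
    by (auto simp: CC_def)
  define A where "A = {z. (x, z) \<in> R \<and> z \<in> V 0}"
  have "\<forall>z\<in>A. \<exists>f. f 0 = z \<and> (\<forall>i\<le>n. (f i, f (Suc i)) \<in> R) \<and>
      (\<forall>i\<in>{1..n}. f i \<in> V i) \<and> f (Suc n) \<in> V 0"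
    using pp unfolding A_def truth_PP by auto
  then obtain F where F: "\<And>z. z \<in> A \<Longrightarrow> F z 0 = z"
      "\<And>z i. z \<in> A \<Longrightarrow> i \<le> n \<Longrightarrow> (F z i, F z (Suc i)) \<in> R"
      "\<And>z i. z \<in> A \<Longrightarrow> i \<in> {1..n} \<Longrightarrow> F z i \<in> V i"
      "\<And>z. z \<in> A \<Longrightarrow> F z (Suc n) \<in> V 0"
    by metis
  \<comment> \<open>By transitivity the paths stay among the successors of \<open>x\<close>, where
    \<open>DD\<close> holds and where \<open>PP\<close> holds at all points of
    \<open>V 0\<close>.\<close>
  have F_R: "(x, F z i) \<in> R" if "z \<in> A" "i \<le> Suc n" for z i
    using that(2)
  proof (induction i)
    case 0
    then show ?case using that(1) F(1) by (simp add: A_def)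
  next
    case (Suc i)
    then show ?case
      using F(2)[OF that(1), of i] assms(2) by (auto dest: transD)
  qed
  have F_V: "F z i \<in> V i" if "z \<in> A" "i \<le> n" for z i
    using that F(1,3)[of z] by (cases "i = 0") (auto simp: A_def)
  \<comment> \<open>\<open>z k\<close> is where the path number \<open>k\<close> starts, and
    \<open>z (Suc k)\<close> is where it ends. In \<open>y\<close>, the block number
    \<open>k\<close> consists of the first \<open>Suc n\<close> points of that path; its last point
    opens the next block.\<close>
  define z where "z k = ((\<lambda>u. F u (Suc n)) ^^ k) z0" for k
  have zA: "z k \<in> A" for k
    using z0 F(4) F_R by (induction k) (auto simp: z_def A_def)
  define y where "y m = F (z (m div Suc n)) (m mod Suc n)" for m
  have mod_le: "m mod Suc n \<le> n" for m
    using mod_less_divisor[of "Suc n" m] by simp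
  have y_R: "(x, y m) \<in> R" for m
    unfolding y_def using F_R[OF zA] mod_le le_SucI by blast
  have z_Suc: "z (Suc k) = F (z k) (Suc n)" for k
    by (simp add: z_def)
  have "y (Suc m) = F (z (m div Suc n)) (Suc (m mod Suc n))" for m
    by (auto simp: y_def mod_Suc div_Suc F(1)[OF zA] simp flip: z_Suc)
  then have "(y m, y (Suc m)) \<in> R" for m
    using F(2)[OF zA mod_le] by (simp add: y_def)
  then have "ascending_chain W R y"
    using y_R assms(1) unfolding ascending_chain_def frame_def by blast
  moreover have "residue_separated n y"
    unfolding residue_separated_def
  proof (intro allI impI)
    fix i j assume "y i = y j"
    \<comment> \<open>The common point carries the variables of both residues, which
      \<open>DD\<close> allows only if they coincide.\<close>
    then have "y i \<in> V (i mod Suc n)" "y i \<in> V (j mod Suc n)"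
      using F_V[OF zA mod_le] unfolding y_def by metis+
    then show "i mod Suc n = j mod Suc n"
      using dd[OF y_R, of i] mod_le unfolding truth_DD by (metis linorder_neqE_nat truth.simps(1))
  qed
  ultimately show thesis by (rule that)
qed

section \<open>Strict chains, clusters and cycles\<close>

lemma strictly_ascending_chain_or_cluster:
  assumes "trans R" and "ascending_chain W R y"
  shows "(\<exists>x. strictly_ascending_chain W R x) \<or> (\<exists>m. \<forall>i>m. \<forall>j>m. (y i, y j) \<in> R)"
proof (cases "\<exists>m. \<forall>i>m. (y i, y m) \<in> R")
  case True
  then obtain m where "\<forall>i>m. (y i, y m) \<in> R" by blast
  \<comment> \<open>From \<open>y i\<close> one returns to \<open>y m\<close> and then ascends to
    \<open>y j\<close>.\<close>
  then have "\<forall>i>m. \<forall>j>m. (y i, y j) \<in> R"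
    using ascending_chain_less[OF assms(2,1)] assms(1) by (meson transD)
  then show ?thesis by blast
next
  case False
  \<comment> \<open>\<open>g m\<close> is a later index from which there is no edge back to
    \<open>y m\<close>; iterating \<open>g\<close> picks a strict subsequence.\<close>
  then obtain g where g: "\<And>m. m < g m" "\<And>m. (y (g m), y m) \<notin> R"
    by metis
  have "strictly_ascending_chain W R (\<lambda>k. y ((g ^^ k) 0))"
    using assms g ascending_chain_less[OF assms(2,1)]
    by (auto simp: strictly_ascending_chain_def ascending_chain_def)
  then show ?thesis by blast
qed

lemma cycle_if_residue_separated:
  assumes "ascending_chain W R y" and "residue_separated n y"
    and "\<forall>i>m. \<forall>j>m. (y i, y j) \<in> R"
  shows "cycle W R (map y [Suc m..<Suc m + Suc n])"
proof -
  have "inj_on y {Suc m..<Suc m + Suc n}"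
  proof (rule linorder_inj_onI')
    fix i j assume ij: "i \<in> {Suc m..<Suc m + Suc n}" "j \<in> {Suc m..<Suc m + Suc n}" "i < j"
    show "y i \<noteq> y j"
    proof
      assume "y i = y j"
      \<comment> \<open>Equal points have congruent indices, but two distinct indices in the window
        differ by at most \<open>n\<close>.\<close>
      then have "Suc n dvd j - i"
        using assms(2) ij(3) unfolding residue_separated_def by (metis less_imp_le mod_eq_dvd_iff_nat)
      then show False
        using ij by (auto dest!: dvd_imp_le)
    qed
  qed
  moreover have "y i \<in> W" for i
    using assms(1) by (auto simp: ascending_chain_def)
  moreover have "k mod Suc n < Suc n" for k
    by simp
  ultimately show ?thesis
    using assms(3) unfolding cycle_def
    by (auto simp: distinct_map simp del: upt_Suc)
qed

text \<open>Winding around \<open>xs\<close> gives period \<open>length xs\<close>, which may clash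
  with residues modulo \<open>Suc n\<close>. By transitivity, however, all points of the cycle are
  mutually related, so its first \<open>Suc n\<close> points can be repeated instead.\<close>

lemma residue_separated_chain_of_cycle:
  assumes "cycle W R xs" and "n < length xs" and "trans R"
  obtains y where "ascending_chain W R y" and "residue_separated n y"
proof -
  let ?k = "length xs"
  have "ascending_chain W R (\<lambda>m. xs ! (m mod ?k))"
    unfolding ascending_chain_def
  proof (intro conjI allI)
    fix m
    have lt: "m mod ?k < ?k"
      using assms(2) by (intro mod_less_divisor) auto
    then show "xs ! (m mod ?k) \<in> W"
      using assms(1) nth_mem unfolding cycle_def by blast
    show "(xs ! (m mod ?k), xs ! (Suc m mod ?k)) \<in> R"
      using assms(1) lt unfolding cycle_def by (metis mod_Suc_eq)
  qed
  note less = ascending_chain_less[OF this assms(3)]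
  have R: "(xs ! i, xs ! j) \<in> R" if "i < ?k" "j < ?k" for i j
    \<comment> \<open>One extra turn puts the target index above \<open>i\<close> even when
      \<open>j \<le> i\<close>.\<close>
    using less[of i "j + ?k"] that by simp
  have lt: "m mod Suc n < ?k" for m
    using assms(2) mod_less_divisor[of "Suc n" m] by linarith
  have "xs ! i \<in> W" if "i < ?k" for i
    using assms(1) that nth_mem unfolding cycle_def by blast
  then have "ascending_chain W R (\<lambda>m. xs ! (m mod Suc n))"
    using R lt unfolding ascending_chain_def by blast
  moreover have "residue_separated n (\<lambda>m. xs ! (m mod Suc n))"
    using assms(1) lt unfolding residue_separated_def cycle_def by (simp add: nth_eq_iff_index_eq)
  ultimately show thesis by (rule that)
qed

section \<open>Characterization of validity\<close>

lemma circumference_le_iff: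
  "circumference W R \<le> enat n \<longleftrightarrow> (\<forall>xs. cycle W R xs \<longrightarrow> length xs \<le> n)"
  unfolding circumference_def Sup_le_iff by auto

lemma valid_CC_iff:
  assumes "frame W R" and "trans R"
  shows "valid W R (CC n Var) \<longleftrightarrow>
     circumference W R \<le> enat n \<and> \<not> (\<exists>x. strictly_ascending_chain W R x)"
proof
  assume v: "valid W R (CC n Var)"
  have no: "\<not> (ascending_chain W R y \<and> residue_separated n y)" for y
    using not_valid_CC_if_residue_separated[OF assms(2)] v by blast
  have "length xs \<le> n" if "cycle W R xs" for xs
    using residue_separated_chain_of_cycle[OF that _ assms(2)] no by (metis not_le)
  \<comment> \<open>A strict chain is injective, hence residue-separated for every modulus.\<close>
  moreover have "\<not> strictly_ascending_chain W R x" for x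
    using no[of x] strictly_ascending_chain_inj[OF _ assms(2), of W x]
    by (auto simp: strictly_ascending_chain_def residue_separated_def dest: injD)
  ultimately show "circumference W R \<le> enat n \<and> \<not> (\<exists>x. strictly_ascending_chain W R x)"
    by (auto simp: circumference_le_iff)
next
  assume c: "circumference W R \<le> enat n \<and> \<not> (\<exists>x. strictly_ascending_chain W R x)"
  show "valid W R (CC n Var)"
  proof (rule ccontr)
    assume "\<not> valid W R (CC n Var)"
    then obtain y where y: "ascending_chain W R y" "residue_separated n y"
      using residue_separated_chain_if_not_valid_CC[OF assms] by blast
    then obtain m where "\<forall>i>m. \<forall>j>m. (y i, y j) \<in> R"
      using strictly_ascending_chain_or_cluster[OF assms(2) y(1)] c by blast
    then have "cycle W R (map y [Suc m..<Suc m + Suc n])"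
      using cycle_if_residue_separated[OF y] by blast
    then have "length (map y [Suc m..<Suc m + Suc n]) \<le> n"
      using c unfolding circumference_le_iff by blast
    then show False
      by (simp del: upt_Suc)
  qed
qed

theorem theorem4p2:
  fixes W :: "'w set" and R :: "('w \<times> 'w) set" and n :: nat
  assumes "frame W R" and "trans R"
  shows "(valid_scheme W R (C_scheme n) \<longleftrightarrow>
            circumference W R \<le> enat n \<and> \<not> (\<exists>x. strictly_ascending_chain W R x)) \<and>
         (finite W \<longrightarrow>
            (valid_scheme W R (C_scheme n) \<longleftrightarrow> circumference W R \<le> enat n))"
proof -
  \<comment> \<open>Injectivity of strict chains rules them out in finite frames, which gives the
    second claim.\<close>
  have "infinite W" if "strictly_ascending_chain W R x" for x
  proof -
    have "range x \<subseteq> W"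
      using that by (auto simp: strictly_ascending_chain_def ascending_chain_def)
    then show ?thesis
      using strictly_ascending_chain_inj[OF that assms(2)] range_inj_infinite finite_subset by blast
  qed
  then show ?thesis
    using valid_CC_iff[OF assms, of n] valid_scheme_C_scheme[OF assms(1), of n] by blast
qed

end
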